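(* Let $n\geq 2$ be an integer and $R\cong \prod_{i=1}^{n}\mathbb{F}_{i}$, where each $\mathbb{F}_{i}$ is a field. Then $sdim(G(R))=2^{n}-2^{n-1}-1$.
   Context: All rings are commutative with identity. $I(R)$ is the set of non-trivial (nonzero proper) ideals of $R$; $G(R)$ is the graph with vertex set $I(R)$ in which distinct $I,J$ are adjacent iff $I\cap J\neq 0$. For a graph $G$ with distance $d$, two vertices $u,v$ are strongly resolved by a vertex $w$ if $d(w,u)=d(w,v)+d(v,u)$ or $d(w,v)=d(w,u)+d(u,v)$. A set $W$ of vertices is a strong resolving set if every two distinct vertices are strongly resolved by some vertex of $W$; $sdim(G)$ is the minimum cardinality of a strong resolving set. *)

theory Defs
  imports "HOL-Algebra.Chinese_Remainder" "Graph_Theory.Graph_Theory"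
begin

text \<open>An undirected simple graph is a loop-free symmetric digraph without parallel arcs.
  Distances are extended reals because the graph may be disconnected
  (the distance is then infinite).\<close>

definition graph_dist :: "('a, 'b) pre_digraph \<Rightarrow> 'a \<Rightarrow> 'a \<Rightarrow> ereal" where
  "graph_dist G u v = wf_digraph.\<mu> G (\<lambda>_. 1) u v"

definition strongly_resolves :: "('a, 'b) pre_digraph \<Rightarrow> 'a \<Rightarrow> 'a \<Rightarrow> 'a \<Rightarrow> bool" where
  "strongly_resolves G w u v \<longleftrightarrow>
     graph_dist G w u = graph_dist G w v + graph_dist G v u \<or>
     graph_dist G w v = graph_dist G w u + graph_dist G u v"

definition strong_resolving_set :: "('a, 'b) pre_digraph \<Rightarrow> 'a set \<Rightarrow> bool" where
  "strong_resolving_set G W \<longleftrightarrow> W \<subseteq> verts G \<and>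
     (\<forall>u\<in>verts G. \<forall>v\<in>verts G. u \<noteq> v \<longrightarrow> (\<exists>w\<in>W. strongly_resolves G w u v))"

definition sdim :: "('a, 'b) pre_digraph \<Rightarrow> enat" where
  "sdim G = (INF W\<in>{W. strong_resolving_set G W}. if finite W then enat (card W) else \<infinity>)"

definition nontrivial_ideals :: "('a, 'm) ring_scheme \<Rightarrow> 'a set set" where
  "nontrivial_ideals R = {I. ideal I R \<and> I \<noteq> {\<zero>\<^bsub>R\<^esub>} \<and> I \<noteq> carrier R}"

definition ideal_intersection_graph :: "('a, 'm) ring_scheme \<Rightarrow> 'a set pair_pre_digraph" where
  "ideal_intersection_graph R =
     \<lparr> pverts = nontrivial_ideals R,
       parcs = {(I, J). I \<in> nontrivial_ideals R \<and> J \<in> nontrivial_ideals R \<and>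
                        I \<noteq> J \<and> I \<inter> J \<noteq> {\<zero>\<^bsub>R\<^esub>}} \<rparr>"

lemma wf_digraph_ideal_intersection_graph: "wf_digraph (ideal_intersection_graph R)"
  by unfold_locales (auto simp: ideal_intersection_graph_def)

lemma loopfree_ideal_intersection_graph: "loopfree_digraph (ideal_intersection_graph R)"
  by unfold_locales (auto simp: ideal_intersection_graph_def)

lemma symmetric_ideal_intersection_graph: "symmetric (ideal_intersection_graph R)"
  by (auto simp: symmetric_def ideal_intersection_graph_def intro!: symI)

lemma graph_dist_ideal_intersection_graph:
  fixes R :: "('a, 'm) ring_scheme"
  defines "G \<equiv> with_proj (ideal_intersection_graph R)"
  shows "graph_dist G u v = (INF p\<in>{p. pre_digraph.awalk G u p v}. ereal (real (length p)))"
proof -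
  interpret wf_digraph G
    unfolding G_def by (rule wf_digraph_ideal_intersection_graph)
  have "awalk_cost (\<lambda>_. 1) p = real (length p)" for p
    by (induction p) auto
  then show ?thesis
    by (simp add: graph_dist_def \<mu>_def)
qed

end

theory Submission
  imports Defs
begin

text \<open>An ideal of a finite product of fields is determined by the set of coordinates on which it
  does not vanish, so the graph is the intersection graph of the nonempty proper subsets of an
  \<open>n\<close>-set. A subset and its complement can only be resolved by one of the two, because any third
  vertex has distance at most 2 from both, while they have distance at least 2 from each other; hence
  a strong resolving set contains at least half of the vertices. Conversely the vertices avoiding a
  fixed point \<open>a\<close> form a strong resolving set: if \<open>A\<close> and \<open>B\<close> are distinct and both contain \<open>a\<close>, say
  with \<open>B\<close> not contained in \<open>A\<close>, then \<open>B - A\<close> is adjacent to \<open>B\<close> and at distance 2 from \<open>A\<close> via \<open>B\<close>.\<close>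

section \<open>Small distances in a digraph\<close>

context wf_digraph
begin

text \<open>Under unit weights the cost of a walk is its length. Stated for an arbitrary well-formed
  digraph, so that the combinatorial argument can run on an abstract graph.\<close>

lemma graph_dist_eq_INF_length:
  "graph_dist G u v = (INF p\<in>{p. awalk u p v}. ereal (real (length p)))"
proof -
  have "awalk_cost (\<lambda>_. 1) p = real (length p)" for p
    by (induction p) auto
  then show ?thesis
    by (simp add: graph_dist_def \<mu>_def)
qed

lemma graph_dist_le_length: "awalk u p v \<Longrightarrow> graph_dist G u v \<le> ereal (real (length p))"
  unfolding graph_dist_eq_INF_length by (rule INF_lower) simp

text \<open>A lower bound for all walks bounds the infimum. If there is no walk, the infimum is
  infinite, so unreachable pairs are covered too.\<close>

lemma graph_dist_geI:
  "(\<And>p. awalk u p v \<Longrightarrow> k \<le> length p) \<Longrightarrow> ereal (real k) \<le> graph_dist G u v"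
  unfolding graph_dist_eq_INF_length by (rule INF_greatest) simp

lemma graph_dist_nonneg: "0 \<le> graph_dist G u v"
  using graph_dist_geI[of u v 0] by (simp add: zero_ereal_def)

lemma graph_dist_self: "u \<in> verts G \<Longrightarrow> graph_dist G u u = 0"
  using graph_dist_le_length[of u "[]" u] graph_dist_nonneg[of u u]
  by (simp add: awalk_Nil_iff zero_ereal_def)

lemma graph_dist_ge_1:
  assumes "u \<noteq> v"
  shows "1 \<le> graph_dist G u v"
proof -
  have "1 \<le> length p" if "awalk u p v" for p
    using that assms by (cases p) (auto simp: awalk_Nil_iff)
  from graph_dist_geI[OF this] show ?thesis
    by (simp add: one_ereal_def)
qed

text \<open>A walk of length 0 forces equal endpoints and a walk of length 1 is an arc between
  them.\<close>

lemma graph_dist_ge_2: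
  assumes "u \<noteq> v" "\<not> u \<rightarrow> v"
  shows "2 \<le> graph_dist G u v"
proof -
  have "2 \<le> length p" if p: "awalk u p v" for p
  proof (cases p)
    case Nil
    with p assms show ?thesis by (auto simp: awalk_Nil_iff)
  next
    case (Cons e q)
    show ?thesis
    proof (cases q)
      case Nil
      with p Cons have "u \<rightarrow> v"
        by (auto simp: awalk_Cons_iff awalk_Nil_iff arcs_ends_conv)
      with assms show ?thesis by simp
    qed (simp add: Cons)
  qed
  from graph_dist_geI[OF this] show ?thesis
    by simp
qed

lemma graph_dist_le_2:
  assumes "u \<rightarrow> x" "x \<rightarrow> v"
  shows "graph_dist G u v \<le> 2"
proof -
  obtain e f where "e \<in> arcs G" "tail G e = u" "head G e = x"
    "f \<in> arcs G" "tail G f = x" "head G f = v"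
    using assms by (auto simp: arcs_ends_conv)
  then have "awalk u [e, f] v"
    by (auto simp: awalk_Cons_iff awalk_Nil_iff)
  from graph_dist_le_length[OF this] show ?thesis
    by simp
qed

lemma graph_dist_eq_1:
  assumes "u \<rightarrow> v" "u \<noteq> v"
  shows "graph_dist G u v = 1"
proof -
  obtain e where "e \<in> arcs G" "tail G e = u" "head G e = v"
    using assms by (auto simp: arcs_ends_conv)
  then have "awalk u [e] v"
    by (auto simp: awalk_Cons_iff awalk_Nil_iff)
  from graph_dist_le_length[OF this] graph_dist_ge_1[OF assms(2)] show ?thesis
    by (simp add: one_ereal_def)
qed

lemma strongly_resolves_left: "u \<in> verts G \<Longrightarrow> strongly_resolves G u u v"
  by (simp add: strongly_resolves_def graph_dist_self)

lemma strongly_resolves_right: "v \<in> verts G \<Longrightarrow> strongly_resolves G v u v"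
  by (simp add: strongly_resolves_def graph_dist_self)

end

lemma strongly_resolves_commute: "strongly_resolves G w u v \<longleftrightarrow> strongly_resolves G w v u"
  by (auto simp: strongly_resolves_def)

section \<open>The intersection graph of the nonempty proper subsets of a finite set\<close>

text \<open>Isolates all that the counting argument needs from the ideal graph: the labelling
  \<open>\<phi>\<close> of vertices by subsets and the adjacency rule. No ring theory enters
  here.\<close>

locale subset_intersection_graph = wf_digraph G
  for G :: "('a, 'b) pre_digraph" +
  fixes N :: "'c set" and \<phi> :: "'a \<Rightarrow> 'c set"
  assumes finite_points: "finite N"
    and bij_subsets: "bij_betw \<phi> (verts G) (Pow N - {{}, N})"
    and dominates_iff:
      "\<And>u v. u \<in> verts G \<Longrightarrow> v \<in> verts G \<Longrightarrow> u \<rightarrow>\<^bsub>G\<^esub> v \<longleftrightarrow> u \<noteq> v \<and> \<phi> u \<inter> \<phi> v \<noteq> {}"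
begin

lemma subset_of_vertex:
  assumes "v \<in> verts G"
  shows "\<phi> v \<subseteq> N" "\<phi> v \<noteq> {}" "\<phi> v \<noteq> N"
  using bij_betwE[OF bij_subsets] assms by auto

lemma obtain_vertex:
  assumes "A \<subseteq> N" "A \<noteq> {}" "A \<noteq> N"
  obtains v where "v \<in> verts G" "\<phi> v = A"
proof -
  have "A \<in> \<phi> ` verts G"
    using assms bij_betw_imp_surj_on[OF bij_subsets] by auto
  with that show ?thesis by blast
qed

lemma subset_eq_iff: "u \<in> verts G \<Longrightarrow> v \<in> verts G \<Longrightarrow> \<phi> u = \<phi> v \<longleftrightarrow> u = v"
  using bij_betw_imp_inj_on[OF bij_subsets] by (auto dest: inj_onD)

text \<open>Subsets that meet are adjacent. If they are disjoint but not complementary, their union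
  is again a proper subset, hence a vertex, and it is adjacent to both.\<close>

lemma graph_dist_le_2_of_not_complement:
  assumes "w \<in> verts G" "v \<in> verts G" "w \<noteq> v" "\<phi> w \<noteq> N - \<phi> v"
  shows "graph_dist G w v \<le> 2"
proof (cases "\<phi> w \<inter> \<phi> v = {}")
  case False
  then have "graph_dist G w v = 1"
    using assms by (intro graph_dist_eq_1) (auto simp: dominates_iff)
  also have "(1::ereal) \<le> 2"
    by (simp add: one_ereal_def)
  finally show ?thesis .
next
  case True
  note w = subset_of_vertex[OF assms(1)] and v = subset_of_vertex[OF assms(2)]
  have "\<phi> w \<union> \<phi> v \<noteq> N"
    using True assms(4) w by blast
  then obtain x where x: "x \<in> verts G" "\<phi> x = \<phi> w \<union> \<phi> v"
    using w v by (metis Un_empty Un_least obtain_vertex)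
  then have "w \<rightarrow>\<^bsub>G\<^esub> x" "x \<rightarrow>\<^bsub>G\<^esub> v"
    using True w v assms(1,2) by (auto simp: dominates_iff)
  then show ?thesis
    by (rule graph_dist_le_2)
qed

lemma complement_strongly_resolved_only_by_self:
  assumes "u \<in> verts G" "v \<in> verts G" "w \<in> verts G" "\<phi> v = N - \<phi> u"
    and "strongly_resolves G w u v"
  shows "w = u \<or> w = v"
proof (rule ccontr)
  assume "\<not> (w = u \<or> w = v)"
  then have ne: "w \<noteq> u" "w \<noteq> v" by auto
  note u = subset_of_vertex[OF assms(1)]
  have *: "\<phi> u = N - \<phi> v"
    using u assms(4) by auto
  \<comment> \<open>As \<open>\<phi>\<close> is injective, \<open>w\<close> differing from
    \<open>u\<close> and \<open>v\<close> is labelled by the complement of neither.\<close>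
  have le: "graph_dist G w u \<le> 2" "graph_dist G w v \<le> 2"
    using graph_dist_le_2_of_not_complement assms(1-4) ne * subset_eq_iff by metis+
  \<comment> \<open>A lower bound suits all sizes of \<open>N\<close>: complementary vertices are at
    distance 2 if \<open>N\<close> has at least three points, but in different components if it has
    two.\<close>
  have "u \<noteq> v" "\<not> u \<rightarrow>\<^bsub>G\<^esub> v" "\<not> v \<rightarrow>\<^bsub>G\<^esub> u"
    using assms(1,2,4) u by (auto simp: dominates_iff)
  then have far: "2 \<le> graph_dist G u v" "2 \<le> graph_dist G v u"
    using graph_dist_ge_2[of u v] graph_dist_ge_2[of v u] by simp_all
  \<comment> \<open>Either equation in the definition of resolving would equate a distance of at
    most 2 with a sum of at least 3.\<close>
  have "1 + 2 \<le> graph_dist G w v + graph_dist G v u" "1 + 2 \<le> graph_dist G w u + graph_dist G u v"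
    using ne far by (blast intro: add_mono graph_dist_ge_1)+
  moreover have "(2::ereal) < 1 + 2"
    by (simp add: one_ereal_def)
  ultimately show False
    using assms(5) le unfolding strongly_resolves_def by (metis leD order.trans)
qed

text \<open>The path from \<open>w\<close> through \<open>v\<close> to \<open>u\<close> is shortest:
  \<open>\<phi> w\<close> lies inside \<open>\<phi> v\<close>, which meets \<open>\<phi> u\<close>,
  but is itself disjoint from \<open>\<phi> u\<close>. So the distance 2 from \<open>w\<close> to
  \<open>u\<close> splits as 1 + 1 at \<open>v\<close>.\<close>

lemma strongly_resolves_difference:
  assumes "u \<in> verts G" "v \<in> verts G" "w \<in> verts G"
    and "\<phi> u \<inter> \<phi> v \<noteq> {}" "\<phi> w = \<phi> v - \<phi> u"
  shows "strongly_resolves G w u v"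
proof -
  note w = subset_of_vertex[OF assms(3)]
  have adj: "w \<rightarrow>\<^bsub>G\<^esub> v" "v \<rightarrow>\<^bsub>G\<^esub> u" and ne: "w \<noteq> v" "v \<noteq> u" "w \<noteq> u" "\<not> w \<rightarrow>\<^bsub>G\<^esub> u"
    using assms w by (auto simp: dominates_iff)
  have "graph_dist G w v = 1" "graph_dist G v u = 1"
    using adj ne by (auto intro: graph_dist_eq_1)
  moreover have "graph_dist G w u = 2"
    using graph_dist_le_2[OF adj] graph_dist_ge_2[OF ne(3,4)] by simp
  ultimately show ?thesis
    by (simp add: strongly_resolves_def one_ereal_def)
qed

section \<open>Lower bound from complementary pairs\<close>

lemma card_verts_le_strong_resolving_set:
  assumes "strong_resolving_set G W" "finite W"
  shows "card (verts G) \<le> 2 * card W"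
proof -
  have W: "W \<subseteq> verts G"
    using assms(1) by (simp add: strong_resolving_set_def)
  \<comment> \<open>\<open>W\<close> must contain a member of each complementary pair, so the labels
    of \<open>W\<close> together with their complements exhaust all labels.\<close>
  have "\<phi> ` verts G \<subseteq> \<phi> ` W \<union> (\<lambda>v. N - \<phi> v) ` W"
  proof
    fix A assume "A \<in> \<phi> ` verts G"
    then obtain u where u: "u \<in> verts G" "A = \<phi> u" by auto
    note A = subset_of_vertex[OF u(1)]
    obtain v where v: "v \<in> verts G" "\<phi> v = N - \<phi> u"
      using obtain_vertex[of "N - \<phi> u"] A by blast
    then have "u \<noteq> v"
      using A by auto
    with assms(1) u v obtain w where w: "w \<in> W" "strongly_resolves G w u v"
      unfolding strong_resolving_set_def by blast
    with complement_strongly_resolved_only_by_self[of u v w] u v W have "w = u \<or> w = v"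
      by auto
    moreover have "\<phi> u = N - \<phi> v"
      using A v by auto
    ultimately show "A \<in> \<phi> ` W \<union> (\<lambda>v. N - \<phi> v) ` W"
      using w u by blast
  qed
  then have "card (\<phi> ` verts G) \<le> card (\<phi> ` W \<union> (\<lambda>v. N - \<phi> v) ` W)"
    using assms(2) by (intro card_mono) auto
  also have "\<dots> \<le> card (\<phi> ` W) + card ((\<lambda>v. N - \<phi> v) ` W)"
    by (rule card_Un_le)
  also have "\<dots> \<le> card W + card W"
    using assms(2) by (intro add_mono card_image_le)
  finally show ?thesis
    by (simp add: card_image bij_betw_imp_inj_on[OF bij_subsets])
qed

section \<open>Upper bound from the vertices avoiding a point\<close>

lemma strong_resolving_set_avoiding_point:
  "strong_resolving_set G {v \<in> verts G. a \<notin> \<phi> v}"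
proof -
  let ?W = "{v \<in> verts G. a \<notin> \<phi> v}"
  have difference: "\<exists>w\<in>?W. strongly_resolves G w u v"
    if uv: "u \<in> verts G" "v \<in> verts G" and a: "a \<in> \<phi> u" "a \<in> \<phi> v"
      and "\<not> \<phi> v \<subseteq> \<phi> u" for u v
  proof -
    \<comment> \<open>The difference is nonempty by assumption, and proper and in \<open>?W\<close>
      because it loses the common point \<open>a\<close>.\<close>
    obtain w where w: "w \<in> verts G" "\<phi> w = \<phi> v - \<phi> u"
      using obtain_vertex[of "\<phi> v - \<phi> u"] subset_of_vertex[OF uv(2)] a \<open>\<not> \<phi> v \<subseteq> \<phi> u\<close> by blast
    moreover have "strongly_resolves G w u v"
      using uv w a by (intro strongly_resolves_difference) auto
    ultimately show ?thesis
      using a by auto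
  qed
  have "\<exists>w\<in>?W. strongly_resolves G w u v"
    if uv: "u \<in> verts G" "v \<in> verts G" "u \<noteq> v" for u v
  proof (cases "a \<in> \<phi> u \<and> a \<in> \<phi> v")
    case False
    \<comment> \<open>One of \<open>u\<close> and \<open>v\<close> avoids \<open>a\<close>, so it
      lies in \<open>?W\<close> and resolves the pair itself.\<close>
    then show ?thesis
      using uv strongly_resolves_left strongly_resolves_right by blast
  next
    case True
    \<comment> \<open>Distinct vertices have distinct labels, so at least one of the two differences
      is nonempty.\<close>
    have "\<not> \<phi> v \<subseteq> \<phi> u \<or> \<not> \<phi> u \<subseteq> \<phi> v"
      using uv subset_eq_iff by blast
    then show ?thesis
      using difference[of u v] difference[of v u] uv True
      by (auto simp: strongly_resolves_commute)
  qed
  then show ?thesis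
    by (auto simp: strong_resolving_set_def)
qed

text \<open>These vertices correspond to the nonempty subsets of \<open>N - {a}\<close>; all of them
  are proper in \<open>N\<close> because they miss \<open>a\<close>.\<close>

lemma card_avoiding_point:
  assumes "a \<in> N"
  shows "card {v \<in> verts G. a \<notin> \<phi> v} = 2 ^ (card N - 1) - 1"
proof -
  let ?W = "{v \<in> verts G. a \<notin> \<phi> v}"
  have "\<phi> ` ?W = Pow (N - {a}) - {{}}"
  proof (intro equalityI subsetI)
    fix A assume A: "A \<in> Pow (N - {a}) - {{}}"
    then have "A \<subseteq> N" "A \<noteq> {}" "A \<noteq> N"
      using assms by auto
    then obtain v where "v \<in> verts G" "\<phi> v = A"
      by (rule obtain_vertex)
    with A show "A \<in> \<phi> ` ?W" by blast
  qed (use subset_of_vertex in auto)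
  moreover have "inj_on \<phi> ?W"
    using bij_betw_imp_inj_on[OF bij_subsets] by (rule inj_on_subset) auto
  ultimately have "card ?W = card (Pow (N - {a}) - {{}})"
    using card_image[of \<phi> ?W] by simp
  then show ?thesis
    using assms finite_points by (simp add: card_Pow)
qed

theorem sdim_eq:
  assumes "N \<noteq> {}"
  shows "sdim G = enat (2 ^ (card N - 1) - 1)"
proof (rule antisym)
  obtain a where a: "a \<in> N"
    using assms by auto
  have fin: "finite (verts G)"
    using bij_betw_finite[OF bij_subsets] finite_points by simp
  show "sdim G \<le> enat (2 ^ (card N - 1) - 1)"
    unfolding sdim_def
    by (rule INF_lower2[of "{v \<in> verts G. a \<notin> \<phi> v}"])
       (simp_all add: strong_resolving_set_avoiding_point card_avoiding_point[OF a] fin)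
  show "enat (2 ^ (card N - 1) - 1) \<le> sdim G"
    unfolding sdim_def
  proof (rule INF_greatest)
    fix W assume "W \<in> {W. strong_resolving_set G W}"
    \<comment> \<open>The vertex set is finite, so the infinite value in the definition of
      \<open>sdim\<close> never arises.\<close>
    then have W: "strong_resolving_set G W" "finite W"
      using fin by (auto simp: strong_resolving_set_def intro: finite_subset)
    have "card (verts G) = card (Pow N - {{}, N})"
      using bij_subsets by (rule bij_betw_same_card)
    also have "\<dots> = 2 ^ card N - 2"
      using finite_points assms by (simp add: card_Diff_subset card_Pow)
    also have "\<dots> = 2 * (2 ^ (card N - 1) - 1)"
      using finite_points assms by (cases "card N") (auto simp: diff_mult_distrib2)
    finally have "2 ^ (card N - 1) - 1 \<le> card W"
      using card_verts_le_strong_resolving_set[OF W] by simp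
    with W show "enat (2 ^ (card N - 1) - 1) \<le> (if finite W then enat (card W) else \<infinity>)"
      by simp
  qed
qed

end

section \<open>Ideals of a finite product of fields\<close>

text \<open>For finite \<open>N\<close> the assumptions say that \<open>R\<close> is the internal direct product of the fields \<open>K i\<close>:
  injectivity is \<open>separated\<close>, and the idempotents \<open>e i\<close> together with surjectivity of each projection
  give surjectivity onto the product.\<close>

locale product_of_fields = ring R
  for R :: "('r, 'm) ring_scheme" (structure) +
  fixes N :: "'i set" and K :: "'i \<Rightarrow> ('f, 'k) ring_scheme" and \<pi> :: "'i \<Rightarrow> 'r \<Rightarrow> 'f"
    and e :: "'i \<Rightarrow> 'r"
  assumes finite_index: "finite N"
    and field_factor: "i \<in> N \<Longrightarrow> field (K i)"
    and proj_hom: "i \<in> N \<Longrightarrow> \<pi> i \<in> ring_hom R (K i)"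
    and proj_surj: "i \<in> N \<Longrightarrow> \<pi> i ` carrier R = carrier (K i)"
    and separated: "x \<in> carrier R \<Longrightarrow> (\<And>i. i \<in> N \<Longrightarrow> \<pi> i x = \<zero>\<^bsub>K i\<^esub>) \<Longrightarrow> x = \<zero>"
    and idem_closed: "i \<in> N \<Longrightarrow> e i \<in> carrier R"
    and proj_idem: "i \<in> N \<Longrightarrow> j \<in> N \<Longrightarrow> \<pi> j (e i) = (if i = j then \<one>\<^bsub>K j\<^esub> else \<zero>\<^bsub>K j\<^esub>)"
begin

section \<open>Correspondence between ideals and supports\<close>

definition ideal_support :: "'r set \<Rightarrow> 'i set" where
  "ideal_support I = {i \<in> N. \<exists>x\<in>I. \<pi> i x \<noteq> \<zero>\<^bsub>K i\<^esub>}"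

text \<open>The intersection of the kernels of the projections outside \<open>S\<close>; it serves
  as the inverse of \<open>ideal_support\<close>.\<close>

definition ideal_of_support :: "'i set \<Rightarrow> 'r set" where
  "ideal_of_support S = {x \<in> carrier R. \<forall>i\<in>N - S. \<pi> i x = \<zero>\<^bsub>K i\<^esub>}"

lemma proj_ring_hom_ring: "i \<in> N \<Longrightarrow> ring_hom_ring R (K i) (\<pi> i)"
  using field_factor proj_hom ring_axioms
  by (intro ring_hom_ringI2) (auto simp: field_def domain_def cring_def)

lemma proj_closed: "i \<in> N \<Longrightarrow> x \<in> carrier R \<Longrightarrow> \<pi> i x \<in> carrier (K i)"
  using proj_hom by (rule ring_hom_closed)

lemma proj_add:
  "i \<in> N \<Longrightarrow> x \<in> carrier R \<Longrightarrow> y \<in> carrier R \<Longrightarrow> \<pi> i (x \<oplus> y) = \<pi> i x \<oplus>\<^bsub>K i\<^esub> \<pi> i y"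
  using proj_hom by (rule ring_hom_add)

lemma proj_mult:
  "i \<in> N \<Longrightarrow> x \<in> carrier R \<Longrightarrow> y \<in> carrier R \<Longrightarrow> \<pi> i (x \<otimes> y) = \<pi> i x \<otimes>\<^bsub>K i\<^esub> \<pi> i y"
  using proj_hom by (rule ring_hom_mult)

lemma proj_zero: "i \<in> N \<Longrightarrow> \<pi> i \<zero> = \<zero>\<^bsub>K i\<^esub>"
proof -
  assume "i \<in> N"
  then interpret ring_hom_ring R "K i" "\<pi> i" by (rule proj_ring_hom_ring)
  show ?thesis by simp
qed

lemma proj_minus: "i \<in> N \<Longrightarrow> x \<in> carrier R \<Longrightarrow> \<pi> i (\<ominus> x) = \<ominus>\<^bsub>K i\<^esub> \<pi> i x"
proof -
  assume "i \<in> N" "x \<in> carrier R"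
  then interpret ring_hom_ring R "K i" "\<pi> i" by (intro proj_ring_hom_ring)
  show ?thesis using \<open>x \<in> carrier R\<close> by simp
qed

lemma factor_ring: "i \<in> N \<Longrightarrow> ring (K i)"
  using proj_ring_hom_ring ring_hom_ring.axioms(2) by blast

lemma factor_one_not_zero: "i \<in> N \<Longrightarrow> \<one>\<^bsub>K i\<^esub> \<noteq> \<zero>\<^bsub>K i\<^esub>"
  using field_factor by (simp add: field_def domain.one_not_zero)

text \<open>Apply \<open>separated\<close> to the difference. Identities in \<open>R\<close> can
  then be checked one coordinate at a time.\<close>

lemma eqI_proj:
  assumes "x \<in> carrier R" "y \<in> carrier R" "\<And>i. i \<in> N \<Longrightarrow> \<pi> i x = \<pi> i y"
  shows "x = y"
proof -
  have "x \<ominus> y = \<zero>"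
  proof (rule separated)
    fix i assume i: "i \<in> N"
    interpret K: ring "K i" using i by (rule factor_ring)
    show "\<pi> i (x \<ominus> y) = \<zero>\<^bsub>K i\<^esub>"
      using assms i by (simp add: a_minus_def proj_add proj_minus proj_closed K.r_neg)
  qed (use assms in auto)
  with assms(1,2) show ?thesis
    by (metis a_minus_def add.inv_closed add.inv_equality minus_minus)
qed

lemma ideal_ideal_of_support: "ideal (ideal_of_support S) R"
proof (rule idealI)
  show "ring R" by (rule ring_axioms)
  show "subgroup (ideal_of_support S) (add_monoid R)"
  proof (rule add.subgroupI)
    show "ideal_of_support S \<noteq> {}"
      using proj_zero by (auto simp: ideal_of_support_def)
    fix x y assume xy: "x \<in> ideal_of_support S" "y \<in> ideal_of_support S"
    show "\<ominus> x \<in> ideal_of_support S"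
      using xy by (auto simp: ideal_of_support_def proj_minus ring.minus_zero[OF factor_ring])
    show "x \<oplus> y \<in> ideal_of_support S"
      using xy by (auto simp: ideal_of_support_def proj_add ring.ring_simprules[OF factor_ring])
  qed (auto simp: ideal_of_support_def)
next
  fix x y assume "x \<in> ideal_of_support S" "y \<in> carrier R"
  then show "y \<otimes> x \<in> ideal_of_support S" "x \<otimes> y \<in> ideal_of_support S"
    by (auto simp: ideal_of_support_def proj_mult proj_closed
        ring.ring_simprules[OF factor_ring])
qed

lemma ideal_support_ideal_of_support:
  assumes "S \<subseteq> N"
  shows "ideal_support (ideal_of_support S) = S"
proof
  show "ideal_support (ideal_of_support S) \<subseteq> S"
    by (auto simp: ideal_support_def ideal_of_support_def)
  show "S \<subseteq> ideal_support (ideal_of_support S)"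
  proof
    fix i assume i: "i \<in> S"
    then have "e i \<in> ideal_of_support S" "\<pi> i (e i) \<noteq> \<zero>\<^bsub>K i\<^esub>"
      using assms by (auto simp: ideal_of_support_def idem_closed proj_idem factor_one_not_zero)
    with i assms show "i \<in> ideal_support (ideal_of_support S)"
      by (auto simp: ideal_support_def)
  qed
qed

text \<open>An element of \<open>I\<close> with nonzero coordinate \<open>i\<close> can be
  normalised: multiply it by a lift of the inverse of that coordinate, and by \<open>e i\<close> to
  kill all other coordinates.\<close>

lemma idem_in_ideal:
  assumes "ideal I R" "i \<in> ideal_support I"
  shows "e i \<in> I"
proof -
  obtain x where i: "i \<in> N" and x: "x \<in> I" "\<pi> i x \<noteq> \<zero>\<^bsub>K i\<^esub>"
    using assms(2) by (auto simp: ideal_support_def)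
  interpret I: ideal I R by fact
  interpret K: field "K i" using i by (rule field_factor)
  have xc: "x \<in> carrier R" using x by simp
  have u: "\<pi> i x \<in> Units (K i)"
    using x i xc by (simp add: K.field_Units proj_closed)
  then obtain s where s: "s \<in> carrier R" "\<pi> i s = inv\<^bsub>K i\<^esub> \<pi> i x"
    using proj_surj[OF i] by (metis K.Units_inv_closed imageE)
  have "e i \<otimes> s \<otimes> x = e i"
  proof (rule eqI_proj)
    fix j assume j: "j \<in> N"
    interpret Kj: field "K j" using j by (rule field_factor)
    show "\<pi> j (e i \<otimes> s \<otimes> x) = \<pi> j (e i)"
      using i j s xc u by (auto simp: proj_mult proj_idem idem_closed proj_closed)
  qed (use i s xc idem_closed in auto)
  moreover have "e i \<otimes> s \<otimes> x \<in> I"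
    using i s x idem_closed by (intro I.I_l_closed) auto
  ultimately show ?thesis by simp
qed

text \<open>Such an \<open>x\<close> is the sum of the products \<open>x \<otimes> e i\<close> over
  \<open>i\<close> in \<open>T\<close>, each of which lies in \<open>I\<close>. A general
  \<open>T\<close> in place of the full support allows induction on \<open>T\<close>.\<close>

lemma mem_ideal_of_vanishing_outside:
  assumes "ideal I R" "T \<subseteq> ideal_support I" "x \<in> carrier R"
    and "\<And>j. j \<in> N - T \<Longrightarrow> \<pi> j x = \<zero>\<^bsub>K j\<^esub>"
  shows "x \<in> I"
proof -
  interpret I: ideal I R by fact
  have "finite T"
    using assms(2) finite_index by (auto simp: ideal_support_def intro: finite_subset)
  then show ?thesis
    using assms(2-)
  proof (induction T arbitrary: x rule: finite_induct)
    case empty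
    then have "x = \<zero>" by (auto intro: separated)
    then show ?case by simp
  next
    case (insert i T)
    then have "i \<in> ideal_support I" by simp
    then have i: "i \<in> N" and ei: "e i \<in> I" "e i \<in> carrier R"
      using idem_in_ideal[OF assms(1)] by (simp_all add: ideal_support_def)
    \<comment> \<open>\<open>?y\<close> agrees with \<open>x\<close> at coordinate \<open>i\<close>
      and vanishes at every other one, so subtracting it clears exactly that coordinate.\<close>
    let ?y = "x \<otimes> e i"
    have y: "?y \<in> I" "?y \<in> carrier R"
      using ei insert.prems by (auto intro: I.I_l_closed)
    have "x \<ominus> ?y \<in> I"
    proof (rule insert.IH)
      fix j assume j: "j \<in> N - T"
      then interpret Kj: field "K j" by (intro field_factor) auto
      interpret Ki: field "K i" using i by (rule field_factor)
      show "\<pi> j (x \<ominus> ?y) = \<zero>\<^bsub>K j\<^esub>"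
        using j i ei y insert.prems
        by (cases "j = i") (auto simp: a_minus_def proj_add proj_minus proj_mult proj_idem proj_closed Ki.r_neg)
    qed (use insert.prems y in auto)
    then have "(x \<ominus> ?y) \<oplus> ?y \<in> I"
      using y by (intro I.a_closed) auto
    moreover have "(x \<ominus> ?y) \<oplus> ?y = x"
      using y insert.prems by (simp add: a_minus_def a_assoc l_neg)
    ultimately show ?case by simp
  qed
qed

lemma ideal_of_support_ideal_support:
  assumes "ideal I R"
  shows "ideal_of_support (ideal_support I) = I"
proof -
  interpret I: ideal I R by fact
  show ?thesis
    using mem_ideal_of_vanishing_outside[OF assms order_refl]
    by (auto simp: ideal_of_support_def ideal_support_def)
qed

lemma ideal_of_support_empty: "ideal_of_support {} = {\<zero>}"
  using separated proj_zero by (auto simp: ideal_of_support_def)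

lemma ideal_of_support_all: "ideal_of_support N = carrier R"
  by (simp add: ideal_of_support_def)

lemma bij_betw_ideal_support:
  "bij_betw ideal_support (nontrivial_ideals R) (Pow N - {{}, N})"
proof (rule bij_betw_byWitness[where f' = ideal_of_support])
  show "\<forall>I\<in>nontrivial_ideals R. ideal_of_support (ideal_support I) = I"
    by (auto simp: nontrivial_ideals_def ideal_of_support_ideal_support)
  show "\<forall>S\<in>Pow N - {{}, N}. ideal_support (ideal_of_support S) = S"
    by (auto simp: ideal_support_ideal_of_support)
  show "ideal_support ` nontrivial_ideals R \<subseteq> Pow N - {{}, N}"
  proof (rule image_subsetI)
    fix I assume "I \<in> nontrivial_ideals R"
    then have "ideal_support I \<noteq> {}" "ideal_support I \<noteq> N"
      using ideal_of_support_ideal_support[of I] ideal_of_support_empty ideal_of_support_all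
      by (auto simp: nontrivial_ideals_def)
    then show "ideal_support I \<in> Pow N - {{}, N}"
      by (auto simp: ideal_support_def)
  qed
  show "ideal_of_support ` (Pow N - {{}, N}) \<subseteq> nontrivial_ideals R"
  proof (rule image_subsetI)
    fix S assume S: "S \<in> Pow N - {{}, N}"
    \<comment> \<open>\<open>ideal_support\<close> is a left inverse on subsets of \<open>N\<close>,
      so different supports give different ideals.\<close>
    then have "ideal_of_support S \<noteq> ideal_of_support {}" "ideal_of_support S \<noteq> ideal_of_support N"
      by (metis DiffE PowD empty_subsetI ideal_support_ideal_of_support insertCI order_refl)+
    then show "ideal_of_support S \<in> nontrivial_ideals R"
      by (simp add: nontrivial_ideals_def ideal_ideal_of_support ideal_of_support_empty
          ideal_of_support_all)
  qed
qed

text \<open>A nonzero common element has a nonzero coordinate, which lies in both supports.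
  Conversely, a common coordinate \<open>i\<close> puts the nonzero idempotent \<open>e i\<close>
  into both ideals.\<close>

lemma ideal_Int_nonzero_iff:
  assumes "ideal I R" "ideal J R"
  shows "I \<inter> J \<noteq> {\<zero>} \<longleftrightarrow> ideal_support I \<inter> ideal_support J \<noteq> {}"
proof
  interpret I: ideal I R by fact
  interpret J: ideal J R by fact
  assume "I \<inter> J \<noteq> {\<zero>}"
  then obtain x where x: "x \<in> I" "x \<in> J" "x \<noteq> \<zero>"
    using I.zero_closed J.zero_closed by blast
  then obtain i where "i \<in> N" "\<pi> i x \<noteq> \<zero>\<^bsub>K i\<^esub>"
    using separated[of x] by auto
  with x show "ideal_support I \<inter> ideal_support J \<noteq> {}"
    by (auto simp: ideal_support_def)
next
  assume "ideal_support I \<inter> ideal_support J \<noteq> {}"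
  then obtain i where i: "i \<in> ideal_support I" "i \<in> ideal_support J" by auto
  then have "i \<in> N" by (simp add: ideal_support_def)
  then have "e i \<noteq> \<zero>"
    using proj_idem[of i i] proj_zero factor_one_not_zero by metis
  with i show "I \<inter> J \<noteq> {\<zero>}"
    using idem_in_ideal assms by blast
qed

lemma subset_intersection_graph_ideals:
  "subset_intersection_graph (with_proj (ideal_intersection_graph R)) N ideal_support"
proof -
  interpret G: wf_digraph "with_proj (ideal_intersection_graph R)"
    by (rule wf_digraph_ideal_intersection_graph)
  show ?thesis
  proof
    show "bij_betw ideal_support (verts (with_proj (ideal_intersection_graph R))) (Pow N - {{}, N})"
      using bij_betw_ideal_support by (simp add: ideal_intersection_graph_def)
  next
    fix I J
    assume "I \<in> verts (with_proj (ideal_intersection_graph R))"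
      "J \<in> verts (with_proj (ideal_intersection_graph R))"
    then show "I \<rightarrow>\<^bsub>with_proj (ideal_intersection_graph R)\<^esub> J \<longleftrightarrow>
        I \<noteq> J \<and> ideal_support I \<inter> ideal_support J \<noteq> {}"
      using ideal_Int_nonzero_iff[of I J]
      by (auto simp: ideal_intersection_graph_def nontrivial_ideals_def)
  qed (rule finite_index)
qed

end

section \<open>Coordinates of the iterated product \<open>RDirProd_list\<close>\<close>

lemma nth_RDirProd_list_hom:
  assumes "i < length Rs"
  shows "(\<lambda>x. x ! i) \<in> ring_hom (RDirProd_list Rs) (Rs ! i)"
  using assms
proof (induction Rs arbitrary: i)
  case (Cons S Rs)
  let ?P = "RDirProd_list (S # Rs)"
  \<comment> \<open>The list product is the binary product of head and tail, transported along the
    map sending a pair to its \<open>Cons\<close>; this makes its operations componentwise.\<close>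
  have mult: "(a # as) \<otimes>\<^bsub>?P\<^esub> (b # bs) = (a \<otimes>\<^bsub>S\<^esub> b) # (as \<otimes>\<^bsub>RDirProd_list Rs\<^esub> bs)"
    and add: "(a # as) \<oplus>\<^bsub>?P\<^esub> (b # bs) = (a \<oplus>\<^bsub>S\<^esub> b) # (as \<oplus>\<^bsub>RDirProd_list Rs\<^esub> bs)"
    if "a \<in> carrier S" "b \<in> carrier S"
      "as \<in> carrier (RDirProd_list Rs)" "bs \<in> carrier (RDirProd_list Rs)" for a b as bs
    using ring_hom_mult[OF RDirProd_list_hom1, of "(a, as)" S Rs "(b, bs)"]
      ring_hom_add[OF RDirProd_list_hom1, of "(a, as)" S Rs "(b, bs)"] that
    by (auto simp: RDirProd_def DirProd_def monoid.defs)
  have one: "\<one>\<^bsub>?P\<^esub> = \<one>\<^bsub>S\<^esub> # \<one>\<^bsub>RDirProd_list Rs\<^esub>"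
    by (simp add: RDirProd_list_one)
  show ?case
  proof (cases i)
    case 0
    then show ?thesis
      by (auto simp: RDirProd_list_carrier mult add one intro!: ring_hom_memI)
  next
    case (Suc k)
    then have "(\<lambda>x. x ! k) \<in> ring_hom (RDirProd_list Rs) (Rs ! k)"
      using Cons by simp
    from ring_hom_memE[OF this] Suc show ?thesis
      by (auto simp: RDirProd_list_carrier mult add one intro!: ring_hom_memI)
  qed
qed simp

lemma nth_RDirProd_list_zero:
  "i < length Rs \<Longrightarrow> \<zero>\<^bsub>RDirProd_list Rs\<^esub> ! i = \<zero>\<^bsub>Rs ! i\<^esub>"
proof (induction Rs arbitrary: i)
  case (Cons S Rs)
  then show ?case
    by (cases i) (simp_all add: RDirProd_list_zero')
qed simp

lemma length_RDirProd_list_zero: "length \<zero>\<^bsub>RDirProd_list Rs\<^esub> = length Rs"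
  unfolding RDirProd_list_zero by (induction Rs) simp_all

text \<open>Transports the coordinate structure along the isomorphism: projections are the
  coordinates after \<open>h\<close>, and idempotents are the preimages of the standard unit
  vectors.\<close>

lemma product_of_fields_RDirProd_list:
  fixes R :: "('r, 'm) ring_scheme" and Ks :: "('f, 'k) ring_scheme list"
  assumes "ring R" and fields: "\<And>i. i < length Ks \<Longrightarrow> field (Ks ! i)"
    and iso: "R \<simeq> RDirProd_list Ks"
  obtains \<pi> e where "product_of_fields R {..<length Ks} (\<lambda>i. Ks ! i) \<pi> e"
proof -
  interpret R: ring R by fact
  let ?P = "RDirProd_list Ks"
  obtain h where h: "h \<in> ring_iso R ?P"
    using iso by (auto simp: is_ring_iso_def)
  then have hom: "h \<in> ring_hom R ?P" and bij: "bij_betw h (carrier R) (carrier ?P)"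
    by (auto simp: ring_iso_def)
  have rings: "ring (Ks ! i)" if "i < length Ks" for i
    using fields[OF that] by (simp add: field_def domain_def cring_def)
  interpret P: ring ?P
    using rings by (rule RDirProd_list_is_ring)
  interpret h: ring_hom_ring R ?P h
    by (rule ring_hom_ringI2) (rule R.ring_axioms P.ring_axioms hom)+
  define \<pi> where "\<pi> = (\<lambda>i r. h r ! i)"
  \<comment> \<open>The entry \<open>a\<close> is kept general: \<open>a\<close> equal to one yields
    the idempotents, while arbitrary \<open>a\<close> shows that the projections are
    surjective.\<close>
  define unit_vec where "unit_vec = (\<lambda>i a. \<zero>\<^bsub>?P\<^esub>[i := a])"
  have unit_vec_closed: "unit_vec i a \<in> carrier ?P" if "i < length Ks" "a \<in> carrier (Ks ! i)" for i a
    using that rings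
    by (intro RDirProd_list_carrier_memI)
       (auto simp: unit_vec_def length_RDirProd_list_zero nth_list_update nth_RDirProd_list_zero
         intro: ring.ring_simprules(2))
  define g where "g = inv_into (carrier R) h"
  have g: "g y \<in> carrier R" "h (g y) = y" if "y \<in> carrier ?P" for y
    using bij that unfolding g_def
    by (auto simp: bij_betw_def inv_into_into f_inv_into_f)
  have "product_of_fields R {..<length Ks} (\<lambda>i. Ks ! i) \<pi> (\<lambda>i. g (unit_vec i \<one>\<^bsub>Ks ! i\<^esub>))"
  proof (intro product_of_fields.intro product_of_fields_axioms.intro)
    show "ring R" by fact
  next
    fix i assume "i \<in> {..<length Ks}"
    then have i: "i < length Ks" by simp
    have one: "\<one>\<^bsub>Ks ! i\<^esub> \<in> carrier (Ks ! i)"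
      using rings[OF i] by (rule ring.ring_simprules(6))
    show "field (Ks ! i)" using i by (rule fields)
    show hom_i: "\<pi> i \<in> ring_hom R (Ks ! i)"
      using ring_hom_trans[OF hom nth_RDirProd_list_hom[OF i]] by (simp add: \<pi>_def comp_def)
    show "\<pi> i ` carrier R = carrier (Ks ! i)"
    proof
      show "\<pi> i ` carrier R \<subseteq> carrier (Ks ! i)"
        using ring_hom_closed[OF hom_i] by auto
      show "carrier (Ks ! i) \<subseteq> \<pi> i ` carrier R"
      proof
        fix a assume a: "a \<in> carrier (Ks ! i)"
        have "\<pi> i (g (unit_vec i a)) = a"
          using g(2)[OF unit_vec_closed[OF i a]] i
          by (simp add: \<pi>_def unit_vec_def length_RDirProd_list_zero)
        then show "a \<in> \<pi> i ` carrier R"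
          using g(1)[OF unit_vec_closed[OF i a]] by (metis imageI)
      qed
    qed
    show "g (unit_vec i \<one>\<^bsub>Ks ! i\<^esub>) \<in> carrier R"
      using g(1) unit_vec_closed i one by blast
    fix j assume "j \<in> {..<length Ks}"
    then show "\<pi> j (g (unit_vec i \<one>\<^bsub>Ks ! i\<^esub>)) = (if i = j then \<one>\<^bsub>Ks ! j\<^esub> else \<zero>\<^bsub>Ks ! j\<^esub>)"
      using g(2)[OF unit_vec_closed[OF i one]] i
      by (simp add: \<pi>_def unit_vec_def length_RDirProd_list_zero nth_list_update nth_RDirProd_list_zero)
  next
    fix x assume x: "x \<in> carrier R" and van: "\<And>i. i \<in> {..<length Ks} \<Longrightarrow> \<pi> i x = \<zero>\<^bsub>Ks ! i\<^esub>"
    have "h x = \<zero>\<^bsub>?P\<^esub>"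
      using RDirProd_list_carrier_mem(1)[OF h.hom_closed[OF x]] van
      by (intro nth_equalityI)
         (auto simp: length_RDirProd_list_zero nth_RDirProd_list_zero \<pi>_def)
    then show "x = \<zero>\<^bsub>R\<^esub>"
      using bij x by (metis R.zero_closed bij_betw_imp_inj_on h.hom_zero inj_onD)
  qed simp
  then show thesis by (rule that)
qed

section \<open>The dimension for a product of \<open>n\<close> fields\<close>

theorem theorem2p9:
  fixes n :: nat
    and R :: "('r, 'm) ring_scheme"
    and F :: "nat \<Rightarrow> ('f, 'k) ring_scheme"
  assumes "n \<ge> 2"
    and "cring R"
    and "\<And>i. i \<in> {1..n} \<Longrightarrow> field (F i)"
    and "R \<simeq> RDirProd_list (map F [1..<Suc n])"
  shows "sdim (ideal_intersection_graph R) = enat (2 ^ n - 2 ^ (n - 1) - 1)"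
proof -
  let ?Ks = "map F [1..<Suc n]"
  \<comment> \<open>List positions start at 0 while the fields are numbered from 1, so position
    \<open>i\<close> holds \<open>F (Suc i)\<close>.\<close>
  have "field (?Ks ! i)" if "i < length ?Ks" for i
    using that assms(3)[of "Suc i"] by (simp del: upt_Suc)
  with assms(2,4) obtain \<pi> e where "product_of_fields R {..<length ?Ks} (\<lambda>i. ?Ks ! i) \<pi> e"
    using product_of_fields_RDirProd_list[of R ?Ks] cring.axioms(1) by blast
  then interpret product_of_fields R "{..<length ?Ks}" "\<lambda>i. ?Ks ! i" \<pi> e .
  interpret G: subset_intersection_graph "with_proj (ideal_intersection_graph R)"
    "{..<length ?Ks}" ideal_support
    by (rule subset_intersection_graph_ideals)
  have "sdim (ideal_intersection_graph R) = enat (2 ^ (n - 1) - 1)"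
    using G.sdim_eq assms(1) by (simp del: upt_Suc add: lessThan_empty_iff)
  moreover have "(2::nat) ^ n - 2 ^ (n - 1) = 2 ^ (n - 1)"
    using assms(1) by (cases n) auto
  ultimately show ?thesis
    by simp
qed

end
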